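(* Consider testing $H_0:\theta=0$ versus $H_a:\theta\neq 0$ based on $\bar X_n\sim\mathcal N(\theta,\sigma^2/n)$, with $\sigma>0$ known. Let $\pi$ be the prior density of $\theta\in\mathbb R$ under $H_a$, and assume that $\pi\in C^3(\mathbb R)$, that $\pi(0)=c_\pi\in(0,\infty)$, and that $|\pi(\theta)|\le C(1+|\theta|^m)$ for all $\theta\in\mathbb R$, for some constants $C,m>0$. Let $\pi_0,\pi_a>0$ be the prior weights of $H_0$ and $H_a$, and use $0$--$1$ loss. Then, with $t=\sqrt n\,\bar x/\sigma$, the Bayes factor in favour of $H_0$ satisfies, as $n\to\infty$, $$BF_{01}(\bar x)=\frac{\sqrt n}{\sigma\sqrt{2\pi}\,c_\pi}\,e^{-t^2/2}\Bigl(1+O\bigl(\sqrt{(\log n)/n}\bigr)\Bigr),$$ uniformly for $\bar x$ on the moderate deviation scale. Setting $BF_{01}=\pi_a/\pi_0$ and solving for $t$ yields the threshold: the critical values $t=t_{\mathrm{crit}}$ on the moderate deviation scale at which $BF_{01}=\pi_a/\pi_0$ satisfy $$t_{\mathrm{crit}}^2=\log n+\log(c_\pi^{-2})-\log(2\pi\sigma^2)+2\log(\pi_0/\pi_a)+O\bigl(\sqrt{(\log n)/n}\bigr).$$ (In $\sqrt{2\pi}$ and $2\pi\sigma^2$, $\pi$ denotes the number $3.14159\ldots$.)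
   Context: For an observed value $\bar x$ of $\bar X_n$, let $f(\bar x\mid\theta)=\frac{\sqrt n}{\sigma\sqrt{2\pi}}\exp\{-n(\bar x-\theta)^2/(2\sigma^2)\}$ be the sampling density. The Bayes factor in favour of $H_0$ is $BF_{01}(\bar x)=f(\bar x\mid 0)/m_a(\bar x)$, where $m_a(\bar x)=\int_{\mathbb R} f(\bar x\mid\theta)\,\pi(\theta)\,d\theta$ is the marginal likelihood under $H_a$. The prior weights are the prior model probabilities $\pi_0=\Pr(H_0)$ and $\pi_a=\Pr(H_a)$. They, the prior density $\pi$ and $\sigma$ are fixed and do not depend on $n$. Under $0$--$1$ loss the Bayes rule, which minimizes the integrated Bayes risk $\pi_0\alpha_n+\pi_a\beta_n$ ($\alpha_n$ the type I error probability and $\beta_n$ the prior-integrated type II error probability), rejects $H_0$ exactly when $BF_{01}<\pi_a/\pi_0$, so $BF_{01}=\pi_a/\pi_0$ is the decision boundary. "Uniformly for $\bar x$ on the moderate deviation scale" means uniformly over $|\bar x|=O(\sqrt{(\log n)/n})$, i.e. for each fixed $K>0$, uniformly over all $\bar x$ with $|\bar x|\le K\sqrt{(\log n)/n}$ (the implied constant may depend on $K$). Likewise $t$ is on the moderate deviation scale when the corresponding $\bar x=\sigma t/\sqrt n$ is. *)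

theory Defs
  imports "HOL-Probability.Probability"
begin

definition C_k :: "nat \<Rightarrow> (real \<Rightarrow> real) \<Rightarrow> bool" where
  "C_k k f \<longleftrightarrow>
     (\<forall>j<k. \<forall>x. ((deriv ^^ j) f) differentiable (at x)) \<and>
     continuous_on UNIV ((deriv ^^ k) f)"

text \<open>Density at \<open>x\<close> of the sample mean of \<open>n\<close> observations; the second argument of
  \<^const>\<open>normal_density\<close> is the standard deviation.\<close>

definition sampling_density :: "real \<Rightarrow> nat \<Rightarrow> real \<Rightarrow> real \<Rightarrow> real" where
  "sampling_density \<sigma> n \<theta> x = normal_density \<theta> (\<sigma> / sqrt (real n)) x"

lemma sampling_density_eq:
  assumes "\<sigma> > 0" "n > 0"
  shows "sampling_density \<sigma> n \<theta> x =
    sqrt (real n) / (\<sigma> * sqrt (2 * pi)) * exp (- (real n * (x - \<theta>)\<^sup>2 / (2 * \<sigma>\<^sup>2)))"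
  using assms
  by (simp add: sampling_density_def normal_density_def power_divide real_sqrt_mult
      real_sqrt_divide field_simps)

definition marginal_alt :: "(real \<Rightarrow> real) \<Rightarrow> real \<Rightarrow> nat \<Rightarrow> real \<Rightarrow> real" where
  "marginal_alt prior \<sigma> n x = (LINT \<theta>|lborel. sampling_density \<sigma> n \<theta> x * prior \<theta>)"

definition BF01 :: "(real \<Rightarrow> real) \<Rightarrow> real \<Rightarrow> nat \<Rightarrow> real \<Rightarrow> real" where
  "BF01 prior \<sigma> n x = sampling_density \<sigma> n 0 x / marginal_alt prior \<sigma> n x"

definition rate :: "nat \<Rightarrow> real" where
  "rate n = sqrt (ln (real n) / real n)"

definition moderate_deviation :: "real \<Rightarrow> nat \<Rightarrow> real set" where
  "moderate_deviation K n = {x. \<bar>x\<bar> \<le> K * rate n}"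

text \<open>With prior weights \<open>p0\<close> of the null and \<open>pa\<close> of the alternative, the Bayes rule under
  0--1 loss rejects the null exactly when the Bayes factor is below \<open>pa / p0\<close>. The critical
  values are the points of the decision boundary, restricted to the moderate deviation scale
  and expressed through \<open>t\<close>, where the sample mean is \<open>\<sigma> * t / sqrt n\<close>.\<close>

definition critical_values ::
  "(real \<Rightarrow> real) \<Rightarrow> real \<Rightarrow> real \<Rightarrow> real \<Rightarrow> real \<Rightarrow> nat \<Rightarrow> real set" where
  "critical_values prior \<sigma> p0 pa K n =
     {t. \<sigma> * t / sqrt (real n) \<in> moderate_deviation K n \<and>
         BF01 prior \<sigma> n (\<sigma> * t / sqrt (real n)) = pa / p0}"

end

theory Submission
  imports Defs "HOL-Real_Asymp.Real_Asymp"
begin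

text \<open>The likelihood \<open>f(x | \<theta>)\<close> is symmetric in \<open>x\<close> and \<open>\<theta>\<close>, so the marginal likelihood under the
  alternative is the average of the prior density over a normal law centred at \<open>x\<close> with standard
  deviation \<open>\<sigma> / sqrt n\<close>.  On the moderate deviation scale both the centre and the spread of this law
  are at most of order \<open>rate n\<close>.  The prior differs from its value \<open>c\<close> at zero by a linear term near zero and
  by a polynomially growing term elsewhere, and the absolute moments of the normal law turn this into
  \<open>m\<^sub>a(x) = c + O(rate n)\<close>, uniformly in \<open>x\<close>
  (\<open>normal_average_linear_error\<close>, \<open>marginal_alt_uniform_limit\<close>).
  Dividing the likelihood under the null by this marginal gives the expansion of the Bayes factor
  (\<open>BF01_uniform_expansion\<close>).

  At a critical value the expansion reads \<open>sqrt n / D * exp (- t\<^sup>2 / 2) * (1 + r) = pa / p0\<close> with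
  \<open>D = \<sigma> * sqrt (2 * pi) * c\<close> and \<open>r = O(rate n)\<close>; taking logarithms, the remainder contributes \<open>2 * ln (1 + r) = O(rate n)\<close> to \<open>t\<^sup>2\<close>
  (\<open>squared_threshold_of_gaussian_equation\<close>).

  Critical values exist for large \<open>n\<close> because the Bayes factor is continuous in \<open>t\<close>, is of order
  \<open>sqrt n\<close> at \<open>t = 0\<close> and of order \<open>1 / sqrt n\<close> at \<open>t = sqrt (2 * ln n)\<close>, which still lies on the
  moderate deviation scale (\<open>critical_values_nonempty\<close>).\<close>

section \<open>Averages over concentrated normal laws\<close>

text \<open>The pointwise estimate is made globally valid by an odd power because the absolute odd moments
  of a normal law are explicit and the linear term is then one of them.  Near zero the linear term
  comes from the derivative; away from zero it also absorbs the constants, and the odd power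
  dominates the growth of \<open>f\<close>.\<close>

lemma linear_plus_odd_power_bound:
  fixes f :: "real \<Rightarrow> real"
  assumes diff: "f differentiable (at 0)"
    and growth: "\<And>\<theta>. \<bar>f \<theta>\<bar> \<le> C * (1 + \<bar>\<theta>\<bar> powr m)"
    and C: "C > 0" and m: "m > 0"
  shows "\<exists>A\<ge>0. \<exists>k. \<forall>\<theta>. \<bar>f \<theta> - f 0\<bar> \<le> A * (\<bar>\<theta>\<bar> + \<bar>\<theta>\<bar> ^ (2 * k + 1))"
proof -
  obtain D where D: "(f has_field_derivative D) (at 0)"
    using diff real_differentiable_def by blast
  then have "((\<lambda>h. (f h - f 0) / h) \<longlongrightarrow> D) (at 0)"
    by (simp add: DERIV_def)
  then have "((\<lambda>h. \<bar>(f h - f 0) / h\<bar>) \<longlongrightarrow> \<bar>D\<bar>) (at 0)"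
    by (rule tendsto_rabs)
  then have "\<forall>\<^sub>F h in at 0. \<bar>(f h - f 0) / h\<bar> < \<bar>D\<bar> + 1"
    by (rule order_tendstoD) simp
  then obtain d where d: "d > 0"
    and near: "\<And>h. h \<noteq> 0 \<Longrightarrow> \<bar>h\<bar> < d \<Longrightarrow> \<bar>(f h - f 0) / h\<bar> < \<bar>D\<bar> + 1"
    unfolding eventually_at by (auto simp: dist_real_def)
  obtain k :: nat where k: "m \<le> real k"
    using real_arch_simple by blast
  define E where "E = 2 * C + \<bar>f 0\<bar>"
  define A where "A = \<bar>D\<bar> + 1 + E / d + C"
  have E: "E \<ge> 0" using C by (simp add: E_def)
  have A: "A \<ge> 0" using C E d by (simp add: A_def)
  have "\<bar>f \<theta> - f 0\<bar> \<le> A * (\<bar>\<theta>\<bar> + \<bar>\<theta>\<bar> ^ (2 * k + 1))" for \<theta>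
  proof (cases "\<bar>\<theta>\<bar> < d")
    case True
    have "\<bar>f \<theta> - f 0\<bar> \<le> (\<bar>D\<bar> + 1) * \<bar>\<theta>\<bar>"
    proof (cases "\<theta> = 0")
      case False
      then show ?thesis
        using near[OF False True] by (simp add: abs_divide field_simps)
    qed simp
    also have "\<dots> \<le> A * (\<bar>\<theta>\<bar> + \<bar>\<theta>\<bar> ^ (2 * k + 1))"
      using C E d by (intro mult_mono) (auto simp: A_def)
    finally show ?thesis .
  next
    case False
    have pw: "\<bar>\<theta>\<bar> powr m \<le> 1 + \<bar>\<theta>\<bar> ^ (2 * k + 1)"
    proof (cases "\<bar>\<theta>\<bar> \<le> 1")
      case True
      then have "\<bar>\<theta>\<bar> powr m \<le> 1" using m by (simp add: powr_le1)
      then show ?thesis by (simp add: add_increasing2)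
    next
      case False
      then have "\<bar>\<theta>\<bar> powr m \<le> \<bar>\<theta>\<bar> powr real (2 * k + 1)"
        using k by (intro powr_mono) auto
      also have "\<dots> = \<bar>\<theta>\<bar> ^ (2 * k + 1)" using False by (intro powr_realpow) simp
      finally show ?thesis by simp
    qed
    have "\<bar>f \<theta> - f 0\<bar> \<le> C * (1 + \<bar>\<theta>\<bar> powr m) + \<bar>f 0\<bar>"
      using growth[of \<theta>] by linarith
    also have "\<dots> \<le> C * (2 + \<bar>\<theta>\<bar> ^ (2 * k + 1)) + \<bar>f 0\<bar>"
      using mult_left_mono[of "1 + \<bar>\<theta>\<bar> powr m" "2 + \<bar>\<theta>\<bar> ^ (2 * k + 1)" C] pw C by simp
    also have "\<dots> = E + C * \<bar>\<theta>\<bar> ^ (2 * k + 1)" by (simp add: E_def algebra_simps)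
    also have "\<dots> \<le> E / d * \<bar>\<theta>\<bar> + C * \<bar>\<theta>\<bar> ^ (2 * k + 1)"
    proof -
      have "E * d \<le> E * \<bar>\<theta>\<bar>" using E False by (intro mult_left_mono) auto
      then show ?thesis using d by (simp add: field_simps)
    qed
    also have "\<dots> \<le> A * \<bar>\<theta>\<bar> + A * \<bar>\<theta>\<bar> ^ (2 * k + 1)"
      using C E d by (intro add_mono mult_right_mono) (auto simp: A_def)
    finally show ?thesis by (simp add: algebra_simps)
  qed
  then show ?thesis using A by blast
qed

text \<open>For a normal variable \<open>\<Theta>\<close> with mean \<open>x\<close> and deviation \<open>s\<close>, the powers of \<open>\<bar>\<Theta>\<bar>\<close> split into powers of
  \<open>\<bar>x\<bar>\<close> and of \<open>\<bar>\<Theta> - x\<bar>\<close>; the \<open>p\<close>-th absolute central moment is a multiple of \<open>s ^ p\<close>.  For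
  \<open>\<bar>x\<bar> \<le> 1\<close> and \<open>s \<le> 1\<close> all these powers are at most linear.\<close>

lemma normal_average_linear_error:
  fixes f :: "real \<Rightarrow> real"
  assumes diff: "f differentiable (at 0)"
    and growth: "\<And>\<theta>. \<bar>f \<theta>\<bar> \<le> C * (1 + \<bar>\<theta>\<bar> powr m)"
    and C: "C > 0" and m: "m > 0"
    and meas [measurable]: "f \<in> borel_measurable borel"
  shows "\<exists>B\<ge>0. \<forall>x s. \<bar>x\<bar> \<le> 1 \<longrightarrow> 0 < s \<longrightarrow> s \<le> 1 \<longrightarrow>
    \<bar>(LINT \<theta>|lborel. normal_density x s \<theta> * f \<theta>) - f 0\<bar> \<le> B * (\<bar>x\<bar> + s)"
proof -
  obtain A k where A: "A \<ge> 0"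
    and bd: "\<And>\<theta>. \<bar>f \<theta> - f 0\<bar> \<le> A * (\<bar>\<theta>\<bar> + \<bar>\<theta>\<bar> ^ (2 * k + 1))"
    using linear_plus_odd_power_bound[OF diff growth C m] by blast
  define p where "p = 2 * k + 1"
  define a0 where "a0 = sqrt (2 / pi)"
  define a where "a = 2 ^ k * fact k * sqrt (2 / pi)"
  define B where "B = A * (1 + 2 ^ p) + A * a0 + A * 2 ^ p * a"
  have a: "a0 \<ge> 0" "a \<ge> 0" by (auto simp: a_def a0_def)
  have B: "B \<ge> 0" using A a by (simp add: B_def)
  have "\<bar>(LINT \<theta>|lborel. normal_density x s \<theta> * f \<theta>) - f 0\<bar> \<le> B * (\<bar>x\<bar> + s)"
    if x: "\<bar>x\<bar> \<le> 1" and s: "0 < s" "s \<le> 1" for x s :: real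
  proof -
    define N where "N = normal_density x s"
    have N0: "N \<theta> \<ge> 0" for \<theta> by (simp add: N_def)
    have [measurable]: "N \<in> borel_measurable borel" by (simp add: N_def)
    have I0: "has_bochner_integral lborel N 1"
      using s by (simp add: N_def has_bochner_integral_iff)
    have I1: "has_bochner_integral lborel (\<lambda>\<theta>. N \<theta> * \<bar>\<theta> - x\<bar>) (a0 * s)"
      using normal_moment_abs_odd[OF s(1), of x 0] by (simp add: N_def a0_def mult_ac)
    have Ip: "has_bochner_integral lborel (\<lambda>\<theta>. N \<theta> * \<bar>\<theta> - x\<bar> ^ p) (a * s ^ p)"
      using normal_moment_abs_odd[OF s(1), of x k] by (simp add: N_def a_def p_def mult_ac)
    \<comment> \<open>A dominating function for the error whose integral is given by the moments above.\<close>
    define G where "G \<theta> = A * (1 + 2 ^ p) * \<bar>x\<bar> * N \<theta> + A * (N \<theta> * \<bar>\<theta> - x\<bar>)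
        + A * 2 ^ p * (N \<theta> * \<bar>\<theta> - x\<bar> ^ p)" for \<theta>
    have IG: "has_bochner_integral lborel G
        (A * (1 + 2 ^ p) * \<bar>x\<bar> * 1 + A * (a0 * s) + A * 2 ^ p * (a * s ^ p))"
      unfolding G_def by (intro has_bochner_integral_add has_bochner_integral_mult_right I0 I1 Ip)
    have point: "N \<theta> * \<bar>f \<theta> - f 0\<bar> \<le> G \<theta>" for \<theta>
    proof -
      let ?y = "\<bar>\<theta> - x\<bar>"
      have le: "\<bar>\<theta>\<bar> \<le> \<bar>x\<bar> + ?y" by linarith
      have "\<bar>\<theta>\<bar> ^ p \<le> (2 * max \<bar>x\<bar> ?y) ^ p"
        using le by (intro power_mono) (auto simp: max_def)
      also have "\<dots> = 2 ^ p * max \<bar>x\<bar> ?y ^ p" by (simp add: power_mult_distrib)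
      also have "\<dots> \<le> 2 ^ p * (\<bar>x\<bar> ^ p + ?y ^ p)"
        by (intro mult_left_mono) (auto simp: max_def)
      also have "\<dots> \<le> 2 ^ p * (\<bar>x\<bar> + ?y ^ p)"
        using power_decreasing[of 1 p "\<bar>x\<bar>"] x by (auto simp: p_def)
      finally have "\<bar>\<theta>\<bar> + \<bar>\<theta>\<bar> ^ p \<le> \<bar>x\<bar> + ?y + 2 ^ p * (\<bar>x\<bar> + ?y ^ p)"
        using le by linarith
      then have "\<bar>f \<theta> - f 0\<bar> \<le> A * (\<bar>x\<bar> + ?y + 2 ^ p * (\<bar>x\<bar> + ?y ^ p))"
        using bd[of \<theta>] A unfolding p_def[symmetric] by (meson mult_left_mono order_trans)
      then have "N \<theta> * \<bar>f \<theta> - f 0\<bar> \<le> N \<theta> * (A * (\<bar>x\<bar> + ?y + 2 ^ p * (\<bar>x\<bar> + ?y ^ p)))"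
        using N0 by (intro mult_left_mono)
      also have "\<dots> = G \<theta>" by (simp add: G_def algebra_simps)
      finally show ?thesis .
    qed
    have iD: "integrable lborel (\<lambda>\<theta>. N \<theta> * (f \<theta> - f 0))"
    proof (rule Bochner_Integration.integrable_bound)
      show "integrable lborel G" using IG by (simp add: has_bochner_integral_iff)
      show "AE \<theta> in lborel. norm (N \<theta> * (f \<theta> - f 0)) \<le> norm (G \<theta>)"
        using point N0 by (auto simp: abs_mult intro: order_trans[OF _ abs_ge_self])
    qed simp
    have iN: "integrable lborel N" "integral\<^sup>L lborel N = 1"
      using I0 by (auto simp: has_bochner_integral_iff)
    have "(LINT \<theta>|lborel. N \<theta> * f \<theta>) = (LINT \<theta>|lborel. N \<theta> * (f \<theta> - f 0) + f 0 * N \<theta>)"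
      by (simp add: algebra_simps)
    also have "\<dots> = (LINT \<theta>|lborel. N \<theta> * (f \<theta> - f 0)) + f 0"
      using iD iN by (subst Bochner_Integration.integral_add) auto
    finally have "\<bar>(LINT \<theta>|lborel. N \<theta> * f \<theta>) - f 0\<bar> = \<bar>LINT \<theta>|lborel. N \<theta> * (f \<theta> - f 0)\<bar>"
      by simp
    also have "\<dots> \<le> (LINT \<theta>|lborel. G \<theta>)"
    proof -
      have "\<bar>LINT \<theta>|lborel. N \<theta> * (f \<theta> - f 0)\<bar> \<le> (LINT \<theta>|lborel. \<bar>N \<theta> * (f \<theta> - f 0)\<bar>)"
        by (rule integral_abs_bound)
      also have "\<dots> \<le> (LINT \<theta>|lborel. G \<theta>)"
        using integrable_abs[OF iD] IG point N0
        by (intro integral_mono) (auto simp: has_bochner_integral_iff abs_mult)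
      finally show ?thesis .
    qed
    also have "\<dots> = A * (1 + 2 ^ p) * \<bar>x\<bar> + A * a0 * s + A * 2 ^ p * a * s ^ p"
      using IG by (simp add: has_bochner_integral_iff mult_ac)
    also have "\<dots> \<le> A * (1 + 2 ^ p) * \<bar>x\<bar> + A * a0 * s + A * 2 ^ p * a * s"
    proof -
      have "s ^ p \<le> s" using power_decreasing[of 1 p s] s by (auto simp: p_def)
      then show ?thesis using A a by (intro add_left_mono mult_left_mono) auto
    qed
    also have "\<dots> \<le> B * \<bar>x\<bar> + B * s"
    proof -
      have "A * (1 + 2 ^ p) \<le> B" "A * a0 + A * 2 ^ p * a \<le> B"
        using A a by (auto simp: B_def)
      then have "A * (1 + 2 ^ p) * \<bar>x\<bar> \<le> B * \<bar>x\<bar>" "(A * a0 + A * 2 ^ p * a) * s \<le> B * s"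
        using s by (auto intro: mult_right_mono)
      then show ?thesis by (simp add: algebra_simps)
    qed
    finally show ?thesis by (simp add: N_def algebra_simps)
  qed
  then show ?thesis using B by blast
qed

text \<open>Dominated convergence: the normal densities of a fixed deviation are bounded by their common
  maximum, so a multiple of \<open>\<bar>f\<bar>\<close> dominates the integrands.\<close>

lemma continuous_normal_average:
  fixes f :: "real \<Rightarrow> real"
  assumes f: "integrable lborel f" and s: "s > 0"
  shows "continuous_on UNIV (\<lambda>x. LINT \<theta>|lborel. normal_density x s \<theta> * f \<theta>)"
proof -
  have [measurable]: "f \<in> borel_measurable borel"
    using borel_measurable_integrable[OF f] by simp
  have "(\<lambda>i. LINT \<theta>|lborel. normal_density (X i) s \<theta> * f \<theta>)
        \<longlonglongrightarrow> (LINT \<theta>|lborel. normal_density x s \<theta> * f \<theta>)"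
    if X: "X \<longlonglongrightarrow> x" for X :: "nat \<Rightarrow> real" and x
  proof (rule integral_dominated_convergence[where w = "\<lambda>\<theta>. 1 / sqrt (2 * pi * s\<^sup>2) * \<bar>f \<theta>\<bar>"])
    show "AE \<theta> in lborel. (\<lambda>i. normal_density (X i) s \<theta> * f \<theta>)
        \<longlonglongrightarrow> normal_density x s \<theta> * f \<theta>"
      unfolding normal_density_def using X s by (intro AE_I2 tendsto_intros) auto
    show "AE \<theta> in lborel. norm (normal_density (X i) s \<theta> * f \<theta>)
        \<le> 1 / sqrt (2 * pi * s\<^sup>2) * \<bar>f \<theta>\<bar>" for i
    proof (rule AE_I2)
      fix \<theta>
      have "normal_density (X i) s \<theta> \<le> 1 / sqrt (2 * pi * s\<^sup>2) * 1"
        unfolding normal_density_def by (intro mult_left_mono) auto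
      then show "norm (normal_density (X i) s \<theta> * f \<theta>) \<le> 1 / sqrt (2 * pi * s\<^sup>2) * \<bar>f \<theta>\<bar>"
        using mult_right_mono[of "normal_density (X i) s \<theta>" "1 / sqrt (2 * pi * s\<^sup>2)" "\<bar>f \<theta>\<bar>"]
        by (simp only: abs_mult real_norm_def abs_of_nonneg[OF normal_density_nonneg] mult_1_right)
    qed
  qed (use f in auto)
  then show ?thesis
    by (auto simp: continuous_on_sequentially o_def)
qed

section \<open>Expansion of the Bayes factor\<close>

lemma marginal_alt_eq_normal_average:
  "marginal_alt prior \<sigma> n x
    = (LINT \<theta>|lborel. normal_density x (\<sigma> / sqrt (real n)) \<theta> * prior \<theta>)"
  by (simp add: marginal_alt_def sampling_density_def normal_density_def power2_commute)

lemma rate_tendsto_0: "rate \<longlonglongrightarrow> 0"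
  unfolding rate_def by real_asymp

text \<open>The spread of the sample mean is negligible against the moderate deviation scale, so that the
  error is governed by the latter.\<close>

lemma eventually_rate_ge: "\<forall>\<^sub>F n in sequentially. 1 / sqrt (real n) \<le> rate n"
  unfolding rate_def by real_asymp

lemma marginal_alt_uniform_limit:
  fixes prior :: "real \<Rightarrow> real"
  assumes \<sigma>: "\<sigma> > 0"
    and diff: "prior differentiable (at 0)"
    and growth: "\<And>\<theta>. \<bar>prior \<theta>\<bar> \<le> C * (1 + \<bar>\<theta>\<bar> powr m)" "C > 0" "m > 0"
    and meas: "prior \<in> borel_measurable borel"
    and K: "K > 0"
  shows "\<exists>M\<ge>0. \<forall>\<^sub>F n in sequentially. \<forall>x\<in>moderate_deviation K n.
    \<bar>marginal_alt prior \<sigma> n x - prior 0\<bar> \<le> M * rate n"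
proof -
  obtain B where B: "B \<ge> 0" and avg: "\<And>x s. \<bar>x\<bar> \<le> 1 \<Longrightarrow> 0 < s \<Longrightarrow> s \<le> 1 \<Longrightarrow>
    \<bar>(LINT \<theta>|lborel. normal_density x s \<theta> * prior \<theta>) - prior 0\<bar> \<le> B * (\<bar>x\<bar> + s)"
    using normal_average_linear_error[OF diff growth meas] by blast
  have "(\<lambda>n. K * rate n) \<longlonglongrightarrow> K * 0" "(\<lambda>n. \<sigma> * rate n) \<longlonglongrightarrow> \<sigma> * 0"
    by (intro tendsto_intros rate_tendsto_0)+
  then have "\<forall>\<^sub>F n in sequentially. K * rate n < 1" "\<forall>\<^sub>F n in sequentially. \<sigma> * rate n < 1"
    by (auto intro: order_tendstoD)
  then have "\<forall>\<^sub>F n in sequentially. \<forall>x\<in>moderate_deviation K n.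
    \<bar>marginal_alt prior \<sigma> n x - prior 0\<bar> \<le> B * (K + \<sigma>) * rate n"
    using eventually_rate_ge eventually_gt_at_top[of 0]
  proof eventually_elim
    case (elim n)
    show ?case
    proof
      fix x assume "x \<in> moderate_deviation K n"
      then have x: "\<bar>x\<bar> \<le> K * rate n" by (simp add: moderate_deviation_def)
      have "\<sigma> * (1 / sqrt (real n)) \<le> \<sigma> * rate n"
        using \<sigma> elim(3) by (intro mult_left_mono) auto
      then have s: "\<sigma> / sqrt (real n) \<le> \<sigma> * rate n" by simp
      then have s1: "\<sigma> / sqrt (real n) \<le> 1" using elim(2) by linarith
      have "\<bar>marginal_alt prior \<sigma> n x - prior 0\<bar> \<le> B * (\<bar>x\<bar> + \<sigma> / sqrt (real n))"
        unfolding marginal_alt_eq_normal_average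
        using x s1 elim \<sigma> by (intro avg) auto
      also have "\<dots> \<le> B * (K * rate n + \<sigma> * rate n)"
        using B x s by (intro mult_left_mono add_mono)
      finally show "\<bar>marginal_alt prior \<sigma> n x - prior 0\<bar> \<le> B * (K + \<sigma>) * rate n"
        by (simp add: algebra_simps)
    qed
  qed
  moreover have "B * (K + \<sigma>) \<ge> 0" using B K \<sigma> by simp
  ultimately show ?thesis by blast
qed

text \<open>The remainder is \<open>r = (c - \<mu>) / \<mu>\<close>, with \<open>\<mu>\<close> the marginal likelihood and \<open>c\<close> the prior density at
  zero; since \<open>\<mu>\<close> is eventually at least \<open>c / 2\<close>, it inherits the rate of \<open>\<mu> - c\<close>.  Positivity
  of \<open>\<mu>\<close> makes the Bayes factor continuous, and \<open>\<bar>r\<bar> \<le> 1/2\<close> keeps \<open>ln (1 + r)\<close> under control.\<close>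

lemma BF01_uniform_expansion:
  fixes prior :: "real \<Rightarrow> real"
  assumes \<sigma>: "\<sigma> > 0"
    and diff: "prior differentiable (at 0)"
    and growth: "\<And>\<theta>. \<bar>prior \<theta>\<bar> \<le> C * (1 + \<bar>\<theta>\<bar> powr m)" "C > 0" "m > 0"
    and meas: "prior \<in> borel_measurable borel"
    and pos: "prior 0 > 0"
    and K: "K > 0"
  shows "\<exists>M\<ge>0. \<forall>\<^sub>F n in sequentially. \<forall>x\<in>moderate_deviation K n.
    0 < marginal_alt prior \<sigma> n x \<and>
    (\<exists>r. \<bar>r\<bar> \<le> M * rate n \<and> \<bar>r\<bar> \<le> 1/2 \<and>
      BF01 prior \<sigma> n x = sqrt (real n) / (\<sigma> * sqrt (2 * pi) * prior 0)
        * exp (- (sqrt (real n) * x / \<sigma>)\<^sup>2 / 2) * (1 + r))"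
proof -
  define c where "c = prior 0"
  have c: "c > 0" using pos by (simp add: c_def)
  obtain M where M: "M \<ge> 0" and lim: "\<forall>\<^sub>F n in sequentially. \<forall>x\<in>moderate_deviation K n.
      \<bar>marginal_alt prior \<sigma> n x - c\<bar> \<le> M * rate n"
    using marginal_alt_uniform_limit[OF \<sigma> diff growth meas K] unfolding c_def by blast
  have "(\<lambda>n. M * rate n) \<longlonglongrightarrow> M * 0"
    by (intro tendsto_intros rate_tendsto_0)
  then have "\<forall>\<^sub>F n in sequentially. M * rate n < c / 4"
    by (rule order_tendstoD) (use c in simp)
  then have "\<forall>\<^sub>F n in sequentially. \<forall>x\<in>moderate_deviation K n.
    0 < marginal_alt prior \<sigma> n x \<and>
    (\<exists>r. \<bar>r\<bar> \<le> 2 * M / c * rate n \<and> \<bar>r\<bar> \<le> 1/2 \<and>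
      BF01 prior \<sigma> n x = sqrt (real n) / (\<sigma> * sqrt (2 * pi) * c)
        * exp (- (sqrt (real n) * x / \<sigma>)\<^sup>2 / 2) * (1 + r))"
    using lim eventually_gt_at_top[of 0]
  proof eventually_elim
    case (elim n)
    show ?case
    proof
      fix x assume x: "x \<in> moderate_deviation K n"
      define \<mu> where "\<mu> = marginal_alt prior \<sigma> n x"
      have \<mu>: "\<bar>\<mu> - c\<bar> \<le> M * rate n" using elim x by (simp add: \<mu>_def)
      have half: "c / 2 \<le> \<mu>" and \<mu>pos: "\<mu> > 0" using \<mu> elim(1) c by linarith+
      define r where "r = (c - \<mu>) / \<mu>"
      have "\<bar>r\<bar> = \<bar>\<mu> - c\<bar> / \<mu>" using \<mu>pos by (simp add: r_def abs_divide)
      also have "\<dots> \<le> (M * rate n) / (c / 2)"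
        using \<mu> half c \<mu>pos by (intro frac_le) auto
      finally have r: "\<bar>r\<bar> \<le> 2 * M / c * rate n" by (simp add: mult_ac)
      have "2 * M / c * rate n = (M * rate n) * 2 / c" by simp
      also have "\<dots> \<le> 1/2" using elim(1) c by (simp add: field_simps)
      finally have "\<bar>r\<bar> \<le> 1/2" using r by linarith
      moreover have "BF01 prior \<sigma> n x = sqrt (real n) / (\<sigma> * sqrt (2 * pi) * c)
        * exp (- (sqrt (real n) * x / \<sigma>)\<^sup>2 / 2) * (1 + r)"
      proof -
        have "1 + r = c / \<mu>" using \<mu>pos by (simp add: r_def field_simps)
        moreover have "- (real n * (x - 0)\<^sup>2 / (2 * \<sigma>\<^sup>2)) = - (sqrt (real n) * x / \<sigma>)\<^sup>2 / 2"
          by (simp add: power_divide power_mult_distrib)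
        ultimately show ?thesis
          unfolding BF01_def \<mu>_def[symmetric] using \<sigma> elim(3) c
          by (simp add: sampling_density_eq)
      qed
      ultimately show "0 < marginal_alt prior \<sigma> n x \<and>
        (\<exists>r. \<bar>r\<bar> \<le> 2 * M / c * rate n \<and> \<bar>r\<bar> \<le> 1/2 \<and>
          BF01 prior \<sigma> n x = sqrt (real n) / (\<sigma> * sqrt (2 * pi) * c)
            * exp (- (sqrt (real n) * x / \<sigma>)\<^sup>2 / 2) * (1 + r))"
        using \<mu>pos r unfolding \<mu>_def by blast
    qed
  qed
  moreover have "2 * M / c \<ge> 0" using M c by simp
  ultimately show ?thesis unfolding c_def by blast
qed

section \<open>Critical values\<close>

text \<open>The intermediate value theorem on \<open>0 \<le> t \<le> sqrt (2 * ln n)\<close>.  The right end corresponds exactly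
  to \<open>x = \<sigma> * sqrt 2 * rate n\<close>, and there \<open>exp (- t\<^sup>2 / 2) = 1 / n\<close> beats the factor \<open>sqrt n\<close>.\<close>

lemma critical_values_nonempty:
  fixes prior :: "real \<Rightarrow> real"
  assumes \<sigma>: "\<sigma> > 0"
    and diff: "prior differentiable (at 0)"
    and growth: "\<And>\<theta>. \<bar>prior \<theta>\<bar> \<le> C * (1 + \<bar>\<theta>\<bar> powr m)" "C > 0" "m > 0"
    and int: "integrable lborel prior"
    and pos: "prior 0 > 0"
    and p: "p0 > 0" "pa > 0"
  shows "\<forall>\<^sub>F n in sequentially. critical_values prior \<sigma> p0 pa (\<sigma> * sqrt 2) n \<noteq> {}"
proof -
  define K where "K = \<sigma> * sqrt 2"
  define D where "D = \<sigma> * sqrt (2 * pi) * prior 0"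
  define q where "q = pa / p0"
  have K: "K > 0" and D: "D > 0" and q: "q > 0" using \<sigma> pos p by (auto simp: K_def D_def q_def)
  have meas: "prior \<in> borel_measurable borel"
    using borel_measurable_integrable[OF int] by simp
  obtain M where expansion: "\<forall>\<^sub>F n in sequentially. \<forall>x\<in>moderate_deviation K n.
    0 < marginal_alt prior \<sigma> n x \<and>
    (\<exists>r. \<bar>r\<bar> \<le> M * rate n \<and> \<bar>r\<bar> \<le> 1/2 \<and>
      BF01 prior \<sigma> n x = sqrt (real n) / D * exp (- (sqrt (real n) * x / \<sigma>)\<^sup>2 / 2) * (1 + r))"
    using BF01_uniform_expansion[OF \<sigma> diff growth meas pos K] unfolding D_def by blast
  \<comment> \<open>These thresholds put the Bayes factor above \<open>q\<close> at \<open>t = 0\<close> and below \<open>q\<close> at the right end,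
    whatever the value of \<open>1 + r\<close> between \<open>1/2\<close> and \<open>3/2\<close>.\<close>
  have "\<forall>\<^sub>F n in sequentially. 2 * D * q < sqrt (real n)"
    "\<forall>\<^sub>F n in sequentially. 3 / (2 * D * q) < sqrt (real n)"
    by real_asymp+
  then show ?thesis
    unfolding K_def[symmetric]
    using expansion eventually_gt_at_top[of 1]
  proof eventually_elim
    case (elim n)
    define T where "T = sqrt (2 * ln (real n))"
    define x where "x t = \<sigma> * t / sqrt (real n)" for t
    have n: "real n > 1" using elim(4) by simp
    have T: "T \<ge> 0" and T2: "T\<^sup>2 = 2 * ln (real n)" using n by (auto simp: T_def)
    have xT: "x T = K * rate n"
      by (simp add: x_def T_def K_def rate_def real_sqrt_mult real_sqrt_divide)
    have scale: "x t \<in> moderate_deviation K n" if "t \<in> {0..T}" for t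
    proof -
      have "\<bar>x t\<bar> = x t" using that \<sigma> by (simp add: x_def)
      also have "\<dots> \<le> x T"
        unfolding x_def using that \<sigma> by (intro divide_right_mono mult_left_mono) auto
      finally show ?thesis by (simp add: moderate_deviation_def xT)
    qed
    have rescale: "sqrt (real n) * x t / \<sigma> = t" for t
      using n \<sigma> by (simp add: x_def)
    have expand: "\<exists>r. \<bar>r\<bar> \<le> 1/2 \<and>
        BF01 prior \<sigma> n (x t) = sqrt (real n) / D * exp (- t\<^sup>2 / 2) * (1 + r)"
      if "t \<in> {0..T}" for t
      using elim(3) scale[OF that] rescale[of t] by metis
    have "q \<le> BF01 prior \<sigma> n (x 0)"
    proof -
      obtain r where r: "\<bar>r\<bar> \<le> 1/2" "BF01 prior \<sigma> n (x 0) = sqrt (real n) / D * (1 + r)"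
        using expand[of 0] T by auto
      have "q \<le> sqrt (real n) / D * (1/2)" using elim(1) D by (simp add: field_simps)
      also have "\<dots> \<le> sqrt (real n) / D * (1 + r)" using r(1) D by (intro mult_left_mono) auto
      finally show ?thesis using r(2) by simp
    qed
    moreover have "BF01 prior \<sigma> n (x T) \<le> q"
    proof -
      obtain r where r: "\<bar>r\<bar> \<le> 1/2"
        "BF01 prior \<sigma> n (x T) = sqrt (real n) / D * exp (- T\<^sup>2 / 2) * (1 + r)"
        using expand[of T] T by auto
      have "exp (- T\<^sup>2 / 2) = 1 / real n" using n T2 by (simp add: exp_minus inverse_eq_divide)
      then have "sqrt (real n) * exp (- T\<^sup>2 / 2) = 1 / sqrt (real n)"
        using sqrt_divide_self_eq[of "real n"] by (simp add: inverse_eq_divide)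
      then have "BF01 prior \<sigma> n (x T) = 1 / sqrt (real n) / D * (1 + r)"
        using r(2) by (metis times_divide_eq_left)
      also have "\<dots> \<le> 1 / sqrt (real n) / D * (3 / 2)"
        using r(1) D by (intro mult_left_mono) auto
      also have "\<dots> \<le> q"
        using elim(2) D q n by (simp add: field_simps)
      finally show ?thesis .
    qed
    moreover have "continuous_on {0..T} (\<lambda>t. BF01 prior \<sigma> n (x t))"
    proof -
      have "continuous_on UNIV (marginal_alt prior \<sigma> n)"
        unfolding marginal_alt_eq_normal_average
        using continuous_normal_average[OF int, of "\<sigma> / sqrt (real n)"] \<sigma> n by simp
      then have "continuous_on {0..T} (\<lambda>t. marginal_alt prior \<sigma> n (x t))"
        unfolding x_def using n
        by (elim continuous_on_compose2) (auto intro!: continuous_intros)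
      moreover have "marginal_alt prior \<sigma> n (x t) \<noteq> 0" if "t \<in> {0..T}" for t
        using elim(3) scale[OF that] by force
      moreover have "continuous_on {0..T} (\<lambda>t. sampling_density \<sigma> n 0 (x t))"
        unfolding sampling_density_def normal_density_def x_def using \<sigma> elim(4)
        by (intro continuous_intros) auto
      ultimately show ?thesis
        unfolding BF01_def by (intro continuous_on_divide) auto
    qed
    ultimately obtain t where "t \<in> {0..T}" "BF01 prior \<sigma> n (x t) = q"
      using IVT2'[of "\<lambda>t. BF01 prior \<sigma> n (x t)" T q 0] T by auto
    then have "t \<in> critical_values prior \<sigma> p0 pa K n"
      using scale by (simp add: critical_values_def x_def q_def)
    then show ?case by blast
  qed
qed

lemma abs_ln_one_plus_le:
  fixes r :: real
  assumes "\<bar>r\<bar> \<le> 1/2"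
  shows "\<bar>ln (1 + r)\<bar> \<le> 2 * \<bar>r\<bar>"
proof -
  have "\<bar>r\<bar> * \<bar>r\<bar> \<le> 1/2 * \<bar>r\<bar>" using assms by (intro mult_right_mono) auto
  then have "2 * r\<^sup>2 \<le> \<bar>r\<bar>" by (simp add: power2_eq_square)
  then show ?thesis using abs_ln_one_plus_x_minus_x_bound[OF assms] by linarith
qed

lemma squared_threshold_of_gaussian_equation:
  fixes n :: nat
  assumes eq: "sqrt (real n) / (\<sigma> * sqrt (2 * pi) * c) * exp (- t\<^sup>2 / 2) * (1 + r) = pa / p0"
    and pos: "n > 0" "\<sigma> > 0" "c > 0" "p0 > 0" "pa > 0"
    and r: "\<bar>r\<bar> \<le> 1/2"
  shows "t\<^sup>2 = ln (real n) + ln (1 / c\<^sup>2) - ln (2 * pi * \<sigma>\<^sup>2) + 2 * ln (p0 / pa) + 2 * ln (1 + r)"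
proof -
  have r1: "1 + r > 0" using r by linarith
  have "ln (pa / p0) = ln (sqrt (real n) / (\<sigma> * sqrt (2 * pi) * c) * exp (- t\<^sup>2 / 2) * (1 + r))"
    using eq by simp
  also have "\<dots> = ln (sqrt (real n)) - (ln \<sigma> + ln (sqrt (2 * pi)) + ln c) - t\<^sup>2 / 2 + ln (1 + r)"
    using pos r1 by (simp add: ln_mult ln_div)
  finally show ?thesis
    using pos by (simp add: ln_mult ln_div ln_sqrt ln_realpow field_simps)
qed

theorem theorem4p1:
  fixes prior :: "real \<Rightarrow> real" and \<sigma> c C m p0 pa :: real
  assumes "\<sigma> > 0"
    and "\<And>\<theta>. prior \<theta> \<ge> 0" and "has_bochner_integral lborel prior 1"
    and "C_k 3 prior"
    and "prior 0 = c" and "c > 0"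
    and "C > 0" and "m > 0" and "\<And>\<theta>. \<bar>prior \<theta>\<bar> \<le> C * (1 + \<bar>\<theta>\<bar> powr m)"
    and "p0 > 0" and "pa > 0"
  shows "(\<forall>K>0. \<exists>M. \<forall>\<^sub>F n in sequentially. \<forall>x\<in>moderate_deviation K n. \<exists>r.
            \<bar>r\<bar> \<le> M * rate n \<and>
            (let t = sqrt (real n) * x / \<sigma> in
             BF01 prior \<sigma> n x =
               sqrt (real n) / (\<sigma> * sqrt (2 * pi) * c) * exp (- t\<^sup>2 / 2) * (1 + r)))
       \<and> (\<exists>K>0. \<forall>\<^sub>F n in sequentially. critical_values prior \<sigma> p0 pa K n \<noteq> {})
       \<and> (\<forall>K>0. \<exists>M. \<forall>\<^sub>F n in sequentially. \<forall>t\<in>critical_values prior \<sigma> p0 pa K n.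
            \<bar>t\<^sup>2 - (ln (real n) + ln (1 / c\<^sup>2) - ln (2 * pi * \<sigma>\<^sup>2) + 2 * ln (p0 / pa))\<bar>
              \<le> M * rate n)"
proof -
  have diff: "prior differentiable (at 0)"
    using \<open>C_k 3 prior\<close> by (auto simp: C_k_def dest: spec[where x = 0])
  have int: "integrable lborel prior"
    using assms(3) by (simp add: has_bochner_integral_iff)
  have meas: "prior \<in> borel_measurable borel"
    using borel_measurable_integrable[OF int] by simp
  have expansion: "\<exists>M. \<forall>\<^sub>F n in sequentially. \<forall>x\<in>moderate_deviation K n.
    \<exists>r. \<bar>r\<bar> \<le> M * rate n \<and> \<bar>r\<bar> \<le> 1/2 \<and>
      BF01 prior \<sigma> n x = sqrt (real n) / (\<sigma> * sqrt (2 * pi) * c)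
        * exp (- (sqrt (real n) * x / \<sigma>)\<^sup>2 / 2) * (1 + r)" if "K > 0" for K
    using BF01_uniform_expansion[OF assms(1) diff assms(9,7,8) meas _ that] assms(5,6)
    by (fast elim: eventually_mono)
  show ?thesis
  proof (intro conjI allI impI)
    fix K :: real assume "K > 0"
    then obtain M where "\<forall>\<^sub>F n in sequentially. \<forall>x\<in>moderate_deviation K n.
      \<exists>r. \<bar>r\<bar> \<le> M * rate n \<and> \<bar>r\<bar> \<le> 1/2 \<and>
        BF01 prior \<sigma> n x = sqrt (real n) / (\<sigma> * sqrt (2 * pi) * c)
          * exp (- (sqrt (real n) * x / \<sigma>)\<^sup>2 / 2) * (1 + r)"
      using expansion by blast
    then have "\<forall>\<^sub>F n in sequentially. \<forall>x\<in>moderate_deviation K n. \<exists>r.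
            \<bar>r\<bar> \<le> M * rate n \<and>
            (let t = sqrt (real n) * x / \<sigma> in
             BF01 prior \<sigma> n x =
               sqrt (real n) / (\<sigma> * sqrt (2 * pi) * c) * exp (- t\<^sup>2 / 2) * (1 + r))"
      unfolding Let_def by (rule eventually_mono) blast
    then show "\<exists>M. \<forall>\<^sub>F n in sequentially. \<forall>x\<in>moderate_deviation K n. \<exists>r.
            \<bar>r\<bar> \<le> M * rate n \<and>
            (let t = sqrt (real n) * x / \<sigma> in
             BF01 prior \<sigma> n x =
               sqrt (real n) / (\<sigma> * sqrt (2 * pi) * c) * exp (- t\<^sup>2 / 2) * (1 + r))"
      by blast
  next
    have "\<forall>\<^sub>F n in sequentially. critical_values prior \<sigma> p0 pa (\<sigma> * sqrt 2) n \<noteq> {}"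
      using critical_values_nonempty[OF assms(1) diff assms(9,7,8) int _ assms(10,11)] assms(5,6)
      by simp
    then show "\<exists>K>0. \<forall>\<^sub>F n in sequentially. critical_values prior \<sigma> p0 pa K n \<noteq> {}"
      using assms(1) by (intro exI[of _ "\<sigma> * sqrt 2"]) simp
  next
    fix K :: real assume "K > 0"
    then obtain M where "\<forall>\<^sub>F n in sequentially. \<forall>x\<in>moderate_deviation K n.
      \<exists>r. \<bar>r\<bar> \<le> M * rate n \<and> \<bar>r\<bar> \<le> 1/2 \<and>
        BF01 prior \<sigma> n x = sqrt (real n) / (\<sigma> * sqrt (2 * pi) * c)
          * exp (- (sqrt (real n) * x / \<sigma>)\<^sup>2 / 2) * (1 + r)"
      using expansion by blast
    then have "\<forall>\<^sub>F n in sequentially. \<forall>t\<in>critical_values prior \<sigma> p0 pa K n.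
            \<bar>t\<^sup>2 - (ln (real n) + ln (1 / c\<^sup>2) - ln (2 * pi * \<sigma>\<^sup>2) + 2 * ln (p0 / pa))\<bar>
              \<le> 4 * M * rate n"
      using eventually_gt_at_top[of 0]
    proof eventually_elim
      case (elim n)
      show ?case
      proof
        fix t assume t: "t \<in> critical_values prior \<sigma> p0 pa K n"
        define x where "x = \<sigma> * t / sqrt (real n)"
        have x: "x \<in> moderate_deviation K n" "BF01 prior \<sigma> n x = pa / p0"
          using t by (auto simp: critical_values_def x_def)
        have "sqrt (real n) * x / \<sigma> = t" using elim(2) assms(1) by (simp add: x_def)
        then obtain r where r: "\<bar>r\<bar> \<le> M * rate n" "\<bar>r\<bar> \<le> 1/2"
          "sqrt (real n) / (\<sigma> * sqrt (2 * pi) * c) * exp (- t\<^sup>2 / 2) * (1 + r) = pa / p0"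
          using elim(1) x by metis
        then show "\<bar>t\<^sup>2 - (ln (real n) + ln (1 / c\<^sup>2) - ln (2 * pi * \<sigma>\<^sup>2) + 2 * ln (p0 / pa))\<bar>
              \<le> 4 * M * rate n"
          using squared_threshold_of_gaussian_equation[OF r(3) elim(2) assms(1,6,10,11) r(2)]
            abs_ln_one_plus_le[OF r(2)] by simp
      qed
    qed
    then show "\<exists>M. \<forall>\<^sub>F n in sequentially. \<forall>t\<in>critical_values prior \<sigma> p0 pa K n.
            \<bar>t\<^sup>2 - (ln (real n) + ln (1 / c\<^sup>2) - ln (2 * pi * \<sigma>\<^sup>2) + 2 * ln (p0 / pa))\<bar>
              \<le> M * rate n"
      by blast
  qed
qed

end
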